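(* Let $V = (v_0 \ldots v_{k-1})$ be a list of distinct symbols and let $f \in \mathcal{T}(V)$ be a polynomial term over $V$. Let $N = (n_0 \ldots n_{\ell-1})$ be a list of integers with $\ell \geq k$, and let $\alpha$ be the assignment $v_i \mapsto n_i$ ($0 \leq i < k$). Then $\mathit{norm}(f,V) \in \mathcal{H}$ and $\mathit{evalh}(\mathit{norm}(f,V),N) = \mathit{evalp}(f,\alpha)$.
   Context: Lists: for a list $s = (s_0 \ldots s_n)$, $\mathit{head}(s) = s_0$ and $s^{(i)}$ is the list obtained by dropping the first $i$ members (empty if there are at most $i$ members). Polynomial terms: $\mathcal{T}(V)$ is the set of formal expressions built from integers and symbols of $V$ using $(+\ y\ z)$, $(-\ y\ z)$, $(-\ y)$, $( *\ y\ z)$ and $(\mathrm{EXPT}\ y\ k)$ with $k \in \mathbb{N}$; $\mathit{evalp}(f,\alpha)$ is the integer obtained by evaluating $f$ in the natural way under an assignment $\alpha$ of integers to the variables. Sparse Horner forms (SHF): an SHF is an integer, or $(\mathrm{POP}\ i\ p)$ with $i \in \mathbb{N}$ and $p$ an SHF, or $(\mathrm{POW}\ i\ p\ q)$ with $i \in \mathbb{N}$ and $p,q$ SHFs. An SHF is normal if its components are normal and it is neither $(\mathrm{POP}\ i\ p)$ with $i=0$ or $p \in \mathbb{Z}$ or $p = (\mathrm{POP}\ j\ q)$, nor $(\mathrm{POW}\ i\ p\ q)$ with $i=0$ or $p = (\mathrm{POW}\ j\ r\ 0)$. $\mathcal{H}$ is the set of normal SHFs. Evaluation: for an SHF $h$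 and an integer list $N$: $\mathit{evalh}(h,N)=h$ if $h \in \mathbb{Z}$; $\mathit{evalh}((\mathrm{POP}\ i\ p),N) = \mathit{evalh}(p,N^{(i)})$; $\mathit{evalh}((\mathrm{POW}\ i\ p\ q),N) = n^i\,\mathit{evalh}(p,N) + \mathit{evalh}(q,N^{(1)})$ if $N$ is nonempty with $\mathit{head}(N)=n$, and $=0$ if $N$ is empty. Basic functions: $\mathit{pop}(i,p)$ is $p$ if $i=0$ or $p \in \mathbb{Z}$; $(\mathrm{POP}\ i+j\ q)$ if $p=(\mathrm{POP}\ j\ q)$; and $(\mathrm{POP}\ i\ p)$ otherwise. For $i \geq 1$, $\mathit{pow}(i,p,q)$ is $\mathit{pop}(1,q)$ if $p=0$; $(\mathrm{POW}\ i+j\ r\ q)$ if $p=(\mathrm{POW}\ j\ r\ 0)$; and $(\mathrm{POW}\ i\ p\ q)$ otherwise. Operations $\oplus$, $\otimes$ on $x,y \in \mathcal{H}$, defined recursively: (1) $x \in \mathbb{Z}$: if $y\in\mathbb{Z}$, $x\oplus y = x+y$, $x \otimes y = xy$; if $y=(\mathrm{POP}\ i\ p)$, $x\oplus y=(\mathrm{POP}\ i\ x\oplus p)$, $x\otimes y=\mathit{pop}(i,x\otimes p)$; if $y=(\mathrm{POW}\ i\ p\ q)$, $x\oplus y=(\mathrm{POW}\ i\ p\ x\oplus q)$, $x\otimes y=\mathit{pow}(i,x\otimes p,x\otimes q)$. (2) $y\in\mathbb{Z}$: $x\oplus y=y\oplus x$, $x\otimes y=y\otimes x$. (3) $x=(\mathrm{POP}\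 i\ p)$, $y=(\mathrm{POP}\ j\ q)$, with $\circ$ denoting $\oplus$ or $\otimes$: $x\circ y=\mathit{pop}(i,p\circ q)$ if $i=j$; $\mathit{pop}(j,(\mathrm{POP}\ i-j\ p)\circ q)$ if $i>j$; $\mathit{pop}(i,(\mathrm{POP}\ j-i\ q)\circ p)$ if $i<j$. (4) $x=(\mathrm{POP}\ i\ p)$, $y=(\mathrm{POW}\ j\ q\ r)$: if $i=1$, $x\oplus y=(\mathrm{POW}\ j\ q\ r\oplus p)$, $x\otimes y=(\mathrm{POW}\ j\ x\otimes q\ p\otimes r)$; if $i>1$, $x\oplus y=(\mathrm{POW}\ j\ q\ r\oplus(\mathrm{POP}\ i-1\ p))$, $x\otimes y=(\mathrm{POW}\ j\ x\otimes q\ (\mathrm{POP}\ i-1\ p)\otimes r)$. (5) $x=(\mathrm{POW}\ j\ q\ r)$, $y=(\mathrm{POP}\ i\ p)$: $x\oplus y=y\oplus x$, $x\otimes y=y\otimes x$. (6) $x=(\mathrm{POW}\ i\ p\ q)$, $y=(\mathrm{POW}\ j\ r\ s)$: $x\oplus y=\mathit{pow}(i,p\oplus r,q\oplus s)$ if $i=j$; $\mathit{pow}(j,(\mathrm{POW}\ i-j\ p\ 0)\oplus r,q\oplus s)$ if $i>j$; $\mathit{pow}(i,(\mathrm{POW}\ j-i\ r\ 0)\oplus p,s\oplus q)$ if $i<j$; and $x\otimes y=(\mathit{pow}(i+j,p\otimes r,q\otimes s)\oplus\mathit{pow}(i,p\otimes\mathit{pop}(1,s),0))\oplus\mathit{pow}(j,r\otimes\mathit{pop}(1,q),0)$.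 Negation: $\ominus x=-x$ for $x\in\mathbb{Z}$, $\ominus(\mathrm{POP}\ i\ p)=(\mathrm{POP}\ i\ \ominus p)$, $\ominus(\mathrm{POW}\ i\ p\ q)=(\mathrm{POW}\ i\ \ominus p\ \ominus q)$. Powers: $x^0=1$, $x^k=x\otimes x^{k-1}$ for $k>0$. Normalization: $\mathit{norm}(x,V)=x$ for $x\in\mathbb{Z}$; $\mathit{norm}(v_i,V)=\mathit{pop}(i,(\mathrm{POW}\ 1\ 1\ 0))$; $\mathit{norm}((-\ y),V)=\ominus\mathit{norm}(y,V)$; $\mathit{norm}((+\ y\ z),V)=\mathit{norm}(y,V)\oplus\mathit{norm}(z,V)$; $\mathit{norm}((-\ y\ z),V)=\mathit{norm}(y,V)\oplus(\ominus\mathit{norm}(z,V))$; $\mathit{norm}(( *\ y\ z),V)=\mathit{norm}(y,V)\otimes\mathit{norm}(z,V)$; $\mathit{norm}((\mathrm{EXPT}\ y\ k),V)=\mathit{norm}(y,V)^k$. *)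

theory Defs
  imports Main
begin

text \<open>\<open>symbols f\<close> is the set of symbols occurring in \<open>f\<close>.\<close>

datatype (symbols: 'a) pterm =
    Const int
  | Var 'a
  | Add "'a pterm" "'a pterm"
  | Sub "'a pterm" "'a pterm"
  | Neg "'a pterm"
  | Mul "'a pterm" "'a pterm"
  | Expt "'a pterm" nat

definition poly_terms :: "'a list \<Rightarrow> 'a pterm set" where
  "poly_terms V = {f. symbols f \<subseteq> set V}"

primrec evalp :: "'a pterm \<Rightarrow> ('a \<Rightarrow> int) \<Rightarrow> int" where
  "evalp (Const c) \<alpha> = c"
| "evalp (Var v) \<alpha> = \<alpha> v"
| "evalp (Add y z) \<alpha> = evalp y \<alpha> + evalp z \<alpha>"
| "evalp (Sub y z) \<alpha> = evalp y \<alpha> - evalp z \<alpha>"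
| "evalp (Neg y) \<alpha> = - evalp y \<alpha>"
| "evalp (Mul y z) \<alpha> = evalp y \<alpha> * evalp z \<alpha>"
| "evalp (Expt y k) \<alpha> = evalp y \<alpha> ^ k"

datatype shf =
    Scalar int
  | POP nat shf
  | POW nat shf shf

text \<open>The normality condition on \<open>POW i p q\<close> does not exclude \<open>p = Scalar 0\<close>.\<close>

primrec normal_shf :: "shf \<Rightarrow> bool" where
  "normal_shf (Scalar c) \<longleftrightarrow> True"
| "normal_shf (POP i p) \<longleftrightarrow>
     normal_shf p \<and> \<not> (i = 0 \<or> (\<exists>c. p = Scalar c) \<or> (\<exists>j q. p = POP j q))"
| "normal_shf (POW i p q) \<longleftrightarrow>
     normal_shf p \<and> normal_shf q \<and> \<not> (i = 0 \<or> (\<exists>j r. p = POW j r (Scalar 0)))"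

definition normal_forms :: "shf set" where
  "normal_forms = {h. normal_shf h}"

primrec evalh :: "shf \<Rightarrow> int list \<Rightarrow> int" where
  "evalh (Scalar c) N = c"
| "evalh (POP i p) N = evalh p (drop i N)"
| "evalh (POW i p q) N =
     (if N = [] then 0 else hd N ^ i * evalh p N + evalh q (drop 1 N))"

definition shf_pop :: "nat \<Rightarrow> shf \<Rightarrow> shf" where
  "shf_pop i p =
     (if i = 0 then p
      else case p of
        Scalar c \<Rightarrow> p
      | POP j q \<Rightarrow> POP (i + j) q
      | POW j q r \<Rightarrow> POP i p)"

definition shf_pow :: "nat \<Rightarrow> shf \<Rightarrow> shf \<Rightarrow> shf" where
  "shf_pow i p q =
     (if p = Scalar 0 then shf_pop 1 q
      else case p of
        POW j r s \<Rightarrow> if s = Scalar 0 then POW (i + j) r q else POW i p q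
      | _ \<Rightarrow> POW i p q)"

text \<open>Termination measures for the two operations: the number of constructors, and, for the
  equations that merely swap the arguments, the kind of the first argument.\<close>

primrec shf_size :: "shf \<Rightarrow> nat" where
  "shf_size (Scalar c) = 1"
| "shf_size (POP i p) = shf_size p + 1"
| "shf_size (POW i p q) = shf_size p + shf_size q + 1"

primrec shf_rank :: "shf \<Rightarrow> nat" where
  "shf_rank (Scalar c) = 0"
| "shf_rank (POP i p) = 1"
| "shf_rank (POW i p q) = 2"

lemma shf_size_pos: "0 < shf_size p"
  by (cases p) auto

lemma shf_size_pop: "shf_size p \<le> n \<Longrightarrow> shf_size (shf_pop i p) < Suc (Suc n)"
  by (auto simp: shf_pop_def split: shf.split)

text \<open>The operations are intended for normal forms only, but are total functions here. Thus in the
  \<open>POP\<close>/\<open>POW\<close> equations the \<open>else\<close> branch is the case \<open>i > 1\<close>; its value for \<open>i = 0\<close>, which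
  no normal form attains, is irrelevant.\<close>

function shf_add :: "shf \<Rightarrow> shf \<Rightarrow> shf" (infixl "\<oplus>" 65) where
  "Scalar a \<oplus> Scalar b = Scalar (a + b)"
| "Scalar a \<oplus> POP i p = POP i (Scalar a \<oplus> p)"
| "Scalar a \<oplus> POW i p q = POW i p (Scalar a \<oplus> q)"
| "POP i p \<oplus> Scalar b = Scalar b \<oplus> POP i p"
| "POW i p q \<oplus> Scalar b = Scalar b \<oplus> POW i p q"
| "POP i p \<oplus> POP j q =
     (if i = j then shf_pop i (p \<oplus> q)
      else if i > j then shf_pop j (POP (i - j) p \<oplus> q)
      else shf_pop i (POP (j - i) q \<oplus> p))"
| "POP i p \<oplus> POW j q r =
     (if i = 1 then POW j q (r \<oplus> p) else POW j q (r \<oplus> POP (i - 1) p))"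
| "POW j q r \<oplus> POP i p = POP i p \<oplus> POW j q r"
| "POW i p q \<oplus> POW j r s =
     (if i = j then shf_pow i (p \<oplus> r) (q \<oplus> s)
      else if i > j then shf_pow j (POW (i - j) p (Scalar 0) \<oplus> r) (q \<oplus> s)
      else shf_pow i (POW (j - i) r (Scalar 0) \<oplus> p) (s \<oplus> q))"
  by pat_completeness auto
termination
  by (relation "measures [\<lambda>(x, y). shf_size x + shf_size y, \<lambda>(x, y). shf_rank x]")
    (use shf_size_pos in \<open>auto simp: Suc_le_eq\<close>)

function shf_mult :: "shf \<Rightarrow> shf \<Rightarrow> shf" (infixl "\<otimes>" 70) where
  "Scalar a \<otimes> Scalar b = Scalar (a * b)"
| "Scalar a \<otimes> POP i p = shf_pop i (Scalar a \<otimes> p)"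
| "Scalar a \<otimes> POW i p q = shf_pow i (Scalar a \<otimes> p) (Scalar a \<otimes> q)"
| "POP i p \<otimes> Scalar b = Scalar b \<otimes> POP i p"
| "POW i p q \<otimes> Scalar b = Scalar b \<otimes> POW i p q"
| "POP i p \<otimes> POP j q =
     (if i = j then shf_pop i (p \<otimes> q)
      else if i > j then shf_pop j (POP (i - j) p \<otimes> q)
      else shf_pop i (POP (j - i) q \<otimes> p))"
| "POP i p \<otimes> POW j q r =
     (if i = 1 then POW j (POP i p \<otimes> q) (p \<otimes> r)
      else POW j (POP i p \<otimes> q) (POP (i - 1) p \<otimes> r))"
| "POW j q r \<otimes> POP i p = POP i p \<otimes> POW j q r"
| "POW i p q \<otimes> POW j r s =
     (shf_pow (i + j) (p \<otimes> r) (q \<otimes> s) \<oplus> shf_pow i (p \<otimes> shf_pop 1 s) (Scalar 0))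
       \<oplus> shf_pow j (r \<otimes> shf_pop 1 q) (Scalar 0)"
  by pat_completeness auto
termination
  by (relation "measures [\<lambda>(x, y). shf_size x + shf_size y, \<lambda>(x, y). shf_rank x]")
    (use shf_size_pos in \<open>auto simp: Suc_le_eq shf_size_pop\<close>)

primrec shf_neg :: "shf \<Rightarrow> shf" ("\<ominus> _" [81] 80) where
  "\<ominus> Scalar c = Scalar (- c)"
| "\<ominus> POP i p = POP i (\<ominus> p)"
| "\<ominus> POW i p q = POW i (\<ominus> p) (\<ominus> q)"

primrec shf_power :: "shf \<Rightarrow> nat \<Rightarrow> shf" where
  "shf_power x 0 = Scalar 1"
| "shf_power x (Suc k) = x \<otimes> shf_power x k"

text \<open>Meaningful only for a member of a list of distinct symbols.\<close>

definition position :: "'a list \<Rightarrow> 'a \<Rightarrow> nat" where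
  "position V v = (THE i. i < length V \<and> V ! i = v)"

primrec shf_norm :: "'a pterm \<Rightarrow> 'a list \<Rightarrow> shf" where
  "shf_norm (Const c) V = Scalar c"
| "shf_norm (Var v) V = shf_pop (position V v) (POW 1 (Scalar 1) (Scalar 0))"
| "shf_norm (Neg y) V = \<ominus> shf_norm y V"
| "shf_norm (Add y z) V = shf_norm y V \<oplus> shf_norm z V"
| "shf_norm (Sub y z) V = shf_norm y V \<oplus> (\<ominus> shf_norm z V)"
| "shf_norm (Mul y z) V = shf_norm y V \<otimes> shf_norm z V"
| "shf_norm (Expt y k) V = shf_power (shf_norm y V) k"

end

theory Submission
  imports Defs
begin

text \<open>
  Normality in the given sense is not preserved by \<open>\<otimes>\<close>, because it admits leading coefficients
  \<open>Scalar 0\<close>: both factors of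
  \<open>POP 1 (POW 1 (Scalar 0) (Scalar 0)) \<otimes> POW 1 (POW 1 (Scalar 1) (POW 1 (Scalar 0) (Scalar 0))) (Scalar 5)\<close>
  are normal, but the product is not. The induction is therefore carried out for normal forms in
  \<open>k\<close> variables whose leading coefficients are nonzero. Such a form, unless it is \<open>Scalar 0\<close>, has a
  nonzero value at generic points: choose the variables from the last to the first, each sufficiently
  large; then in \<open>POW i p q\<close> the term \<open>n ^ i * p\<close> dominates \<open>q\<close>. Hence products of nonzero forms are
  nonzero. For \<open>POP i p \<otimes> POW j q r\<close> to be normal, \<open>POP i p \<otimes> q\<close> must moreover not be of the form
  \<open>POW m u (Scalar 0)\<close>; such a form vanishes when the first variable is \<open>0\<close>, whereas \<open>POP i p\<close> and \<open>q\<close>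
  remain generically nonzero there.
\<close>

section \<open>Reduced forms, their constructors and addition\<close>

primrec reduced :: "nat \<Rightarrow> shf \<Rightarrow> bool" where
  "reduced k (Scalar c) \<longleftrightarrow> True"
| "reduced k (POP i p) \<longleftrightarrow> 0 < i \<and> i \<le> k \<and> (\<exists>j q r. p = POW j q r) \<and> reduced (k - i) p"
| "reduced k (POW i p q) \<longleftrightarrow>
     0 < k \<and> 0 < i \<and> p \<noteq> Scalar 0 \<and> (\<forall>j r. p \<noteq> POW j r (Scalar 0)) \<and>
     reduced k p \<and> reduced (k - 1) q"

lemma reduced_imp_normal: "reduced k h \<Longrightarrow> normal_shf h"
  by (induction h arbitrary: k) auto

lemma reduced_pop: "i \<le> k \<Longrightarrow> reduced (k - i) p \<Longrightarrow> reduced k (shf_pop i p)"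
  by (auto simp: shf_pop_def split: shf.split)

lemma reduced_pow:
  "0 < k \<Longrightarrow> 0 < i \<Longrightarrow> reduced k p \<Longrightarrow> reduced (k - 1) q \<Longrightarrow> reduced k (shf_pow i p q)"
  by (auto simp: shf_pow_def intro: reduced_pop split: shf.split)

lemma evalh_pop [simp]: "evalh (shf_pop i p) N = evalh p (drop i N)"
  by (auto simp: shf_pop_def add.commute split: shf.split)

lemma evalh_pow [simp]:
  "N \<noteq> [] \<Longrightarrow> evalh (shf_pow i p q) N = hd N ^ i * evalh p N + evalh q (drop 1 N)"
  by (auto simp: shf_pow_def power_add split: shf.split)

text \<open>The lists have length exactly \<open>k\<close> because \<open>reduced\<close> then
  prevents any \<open>POW\<close> from being evaluated at \<open>[]\<close>. There its default value
  0 breaks additivity, for instance in \<open>Scalar 1 \<oplus> POW i p q\<close>.\<close>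

lemma shf_add_correct:
  "reduced k x \<Longrightarrow> reduced k y \<Longrightarrow>
    reduced k (x \<oplus> y) \<and> (\<forall>N. length N = k \<longrightarrow> evalh (x \<oplus> y) N = evalh x N + evalh y N)"
proof (induction x y arbitrary: k rule: shf_add.induct)
  case (2 a i p)
  then show ?case using 2(1)[of "k - i"] by auto
next
  case (3 a i p q)
  then show ?case by (auto simp: algebra_simps)
next
  case (4 i p b)
  then show ?case by (metis shf_add.simps(4) add.commute)
next
  case (5 i p q b)
  then show ?case by (metis shf_add.simps(5) add.commute)
next
  case (6 i p j q)
  consider "i = j" | "j < i" | "i < j" by linarith
  then show ?case
  proof cases
    case 1
    then show ?thesis using 6(1)[of "k - i"] 6(4,5) by (auto intro: reduced_pop)
  next
    case 2
    then have "reduced (k - j) (POP (i - j) p)" "reduced (k - j) q" "j \<le> k"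
      using 6(4,5) by auto
    then show ?thesis
      using 6(2)[of "k - j"] 2 by (simp add: reduced_pop ac_simps del: reduced.simps(2))
  next
    case 3
    then have "reduced (k - i) (POP (j - i) q)" "reduced (k - i) p" "i \<le> k"
      using 6(4,5) by auto
    then show ?thesis
      using 6(3)[of "k - i"] 3 by (simp add: reduced_pop ac_simps del: reduced.simps(2))
  qed
next
  case (7 i p j q r)
  show ?case
  proof (cases "i = 1")
    case True
    then show ?thesis using 7(1)[of "k - 1"] 7(3,4) by auto
  next
    case False
    with 7(3,4) have "reduced (k - 1) (POP (i - 1) p)" "reduced (k - 1) r" "i - 1 + 1 = i" by auto
    then show ?thesis using 7(2)[of "k - 1"] 7(4) False by (auto simp del: reduced.simps(2))
  qed
next
  case (8 j q r i p)
  then show ?case by (metis shf_add.simps(8) add.commute)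
next
  case (9 i p q j r s)
  consider "i = j" | "j < i" | "i < j" by linarith
  then show ?case
  proof cases
    case 1
    then show ?thesis using 9(1)[of k] 9(2)[of "k - 1"] 9(7,8)
      by (auto intro!: reduced_pow simp: algebra_simps)
  next
    case 2
    then have "\<And>n::int. n ^ i = n ^ j * n ^ (i - j)" by (simp flip: power_add)
    then show ?thesis using 2 9(3)[of k] 9(4)[of "k - 1"] 9(7,8)
      by (auto intro!: reduced_pow simp: algebra_simps)
  next
    case 3
    then have "\<And>n::int. n ^ j = n ^ i * n ^ (j - i)" by (simp flip: power_add)
    then show ?thesis using 3 9(5)[of k] 9(6)[of "k - 1"] 9(7,8)
      by (auto intro!: reduced_pow simp: algebra_simps)
  qed
qed simp_all

lemmas reduced_add = shf_add_correct[THEN conjunct1]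
lemmas evalh_add = shf_add_correct[THEN conjunct2, rule_format]

section \<open>Generic points and nonvanishing\<close>

text \<open>The quantifier for the head is innermost, so its threshold may depend on the tail. This
  matches \<open>POW i p q\<close>, where \<open>q\<close> sees only the tail.\<close>

primrec generic :: "nat \<Rightarrow> (int list \<Rightarrow> bool) \<Rightarrow> bool" where
  "generic 0 P \<longleftrightarrow> P []"
| "generic (Suc k) P \<longleftrightarrow> generic k (\<lambda>N. \<forall>\<^sub>F n in at_top. P (n # N))"

lemma generic_mono: "generic k P \<Longrightarrow> (\<And>N. length N = k \<Longrightarrow> P N \<Longrightarrow> Q N) \<Longrightarrow> generic k Q"
proof (induction k arbitrary: P Q)
  case (Suc k)
  show ?case
    unfolding generic.simps
    by (rule Suc.IH[OF Suc.prems(1)[unfolded generic.simps]])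
      (auto elim!: eventually_mono intro: Suc.prems(2))
qed simp

lemma generic_conj: "generic k P \<Longrightarrow> generic k Q \<Longrightarrow> generic k (\<lambda>N. P N \<and> Q N)"
  by (induction k arbitrary: P Q) (auto simp: eventually_conj_iff)

lemma generic_True: "generic k (\<lambda>N. True)"
  by (induction k) auto

lemma not_generic_False: "\<not> generic k (\<lambda>N. False)"
  by (induction k) auto

lemma generic_drop: "i \<le> k \<Longrightarrow> generic (k - i) P \<Longrightarrow> generic k (\<lambda>N. P (drop i N))"
proof (induction k arbitrary: i)
  case (Suc k)
  then show ?case by (cases i) auto
qed simp

lemma generic_nonzero:
  "reduced k h \<Longrightarrow> h \<noteq> Scalar 0 \<Longrightarrow> generic k (\<lambda>N. evalh h N \<noteq> 0)"
proof (induction h arbitrary: k)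
  case (Scalar c)
  then show ?case by (simp add: generic_True)
next
  case (POP i p)
  then have "generic (k - i) (\<lambda>N. evalh p N \<noteq> 0)" "i \<le> k" by auto
  then show ?case using generic_drop[where P = "\<lambda>N. evalh p N \<noteq> 0"] by simp
next
  case (POW i p q)
  then obtain m where k: "k = Suc m" and i: "0 < i" by (cases k) auto
  \<comment> \<open>\<open>c\<close> will be the value of \<open>q\<close>, fixed once the tail is
    chosen. \<open>f n\<close>, the value of \<open>p\<close>, may vary arbitrarily with
    \<open>n\<close>, but as a nonzero integer it has absolute value at least 1, so
    \<open>n > \<bar>c\<bar>\<close> is large enough.\<close>
  have dominated: "\<forall>\<^sub>F n in at_top. n ^ i * f n + c \<noteq> 0"
    if "\<forall>\<^sub>F n in at_top. f n \<noteq> 0" for f :: "int \<Rightarrow> int" and c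
    using that eventually_gt_at_top[of "\<bar>c\<bar>"]
  proof eventually_elim
    case (elim n)
    then have "0 < n" "1 \<le> \<bar>f n\<bar>" by auto
    have "\<bar>c\<bar> < n" by fact
    also have "n \<le> n ^ i" using \<open>0 < n\<close> i by (simp add: self_le_power)
    also have "\<dots> \<le> n ^ i * \<bar>f n\<bar>" using \<open>0 < n\<close> \<open>1 \<le> \<bar>f n\<bar>\<close> by simp
    also have "\<dots> = \<bar>n ^ i * f n\<bar>" using \<open>0 < n\<close> by (simp add: abs_mult)
    finally show ?case by linarith
  qed
  have "generic m (\<lambda>N. \<forall>\<^sub>F n in at_top. evalh p (n # N) \<noteq> 0)"
    using POW.IH(1)[of k] POW.prems k by simp
  then have "generic m (\<lambda>N. \<forall>\<^sub>F n in at_top. n ^ i * evalh p (n # N) + evalh q N \<noteq> 0)"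
    by (rule generic_mono) (rule dominated)
  then show ?case by (simp add: k)
qed

text \<open>Only the values of \<open>z\<close> matter. This lets the lemma serve inside the
  induction that first establishes these values for \<open>\<otimes>\<close>.\<close>

lemma evalh_product_nonzero:
  assumes "reduced k x" "reduced k y" "x \<noteq> Scalar 0" "y \<noteq> Scalar 0"
    and eval: "\<And>N. length N = k \<Longrightarrow> evalh z N = evalh x N * evalh y N"
  shows "z \<noteq> Scalar 0"
proof
  assume "z = Scalar 0"
  moreover have "generic k (\<lambda>N. evalh x N \<noteq> 0 \<and> evalh y N \<noteq> 0)"
    using assms by (intro generic_conj generic_nonzero)
  ultimately have "generic k (\<lambda>N. False)"
    by (elim generic_mono) (use eval in fastforce)
  then show False by (simp add: not_generic_False)
qed

text \<open>When the first variable is 0, \<open>POW i p q\<close> reduces to \<open>q\<close>,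
  which is nonzero by \<open>no_pow\<close>. A \<open>POP\<close> ignores the first
  variable.\<close>

lemma generic_nonzero_at_0:
  assumes "reduced k h" "0 < k" "h \<noteq> Scalar 0" and no_pow: "\<And>i p. h \<noteq> POW i p (Scalar 0)"
  shows "generic (k - 1) (\<lambda>N. evalh h (0 # N) \<noteq> 0)"
proof (cases h)
  case (Scalar c)
  with assms show ?thesis by (simp add: generic_True)
next
  case (POP i p)
  \<comment> \<open>This is \<open>h\<close> with the ignored first variable removed;
    \<open>shf_pop\<close> also covers \<open>i = 1\<close>.\<close>
  let ?h = "shf_pop (i - 1) p"
  have "reduced (k - 1) ?h" "?h \<noteq> Scalar 0"
    using assms(1) POP by (cases "i = 1"; auto simp: shf_pop_def)+
  then have "generic (k - 1) (\<lambda>N. evalh ?h N \<noteq> 0)" by (rule generic_nonzero)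
  then show ?thesis
    using assms(1) POP by (elim generic_mono) (auto simp: drop_Cons')
next
  case (POW i p q)
  with assms have "generic (k - 1) (\<lambda>N. evalh q N \<noteq> 0)" by (auto intro!: generic_nonzero)
  with assms(1) POW show ?thesis by (auto elim!: generic_mono simp: power_0_left)
qed

section \<open>Multiplication\<close>

text \<open>The two conclusions need a joint induction: \<open>POP i p \<otimes> POW j q r\<close>
  uses the bare constructor \<open>POW\<close>, and its leading coefficient
  \<open>POP i p \<otimes> q\<close> is shown to be admissible through its values.\<close>

lemma shf_mult_correct:
  "reduced k x \<Longrightarrow> reduced k y \<Longrightarrow>
    reduced k (x \<otimes> y) \<and> (\<forall>N. length N = k \<longrightarrow> evalh (x \<otimes> y) N = evalh x N * evalh y N)"
proof (induction x y arbitrary: k rule: shf_mult.induct)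
  case (2 a i p)
  then show ?case using 2(1)[of "k - i"] by (auto intro!: reduced_pop)
next
  case (3 a i p q)
  then show ?case by (auto intro!: reduced_pow simp: algebra_simps)
next
  case (4 i p b)
  then show ?case by (metis shf_mult.simps(4) mult.commute)
next
  case (5 i p q b)
  then show ?case by (metis shf_mult.simps(5) mult.commute)
next
  case (6 i p j q)
  consider "i = j" | "j < i" | "i < j" by linarith
  then show ?case
  proof cases
    case 1
    then show ?thesis using 6(1)[of "k - i"] 6(4,5) by (auto intro: reduced_pop)
  next
    case 2
    then have "reduced (k - j) (POP (i - j) p)" "reduced (k - j) q" "j \<le> k"
      using 6(4,5) by auto
    then show ?thesis
      using 6(2)[of "k - j"] 2 by (simp add: reduced_pop ac_simps del: reduced.simps(2))
  next
    case 3
    then have "reduced (k - i) (POP (j - i) q)" "reduced (k - i) p" "i \<le> k"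
      using 6(4,5) by auto
    then show ?thesis
      using 6(3)[of "k - i"] 3 by (simp add: reduced_pop ac_simps del: reduced.simps(2))
  qed
next
  case (7 i p j q r)
  define p' where "p' = (if i = 1 then p else POP (i - 1) p)"
  have x: "0 < i" "reduced k (POP i p)" and y: "0 < k" "0 < j" "q \<noteq> Scalar 0"
    "\<And>m u. q \<noteq> POW m u (Scalar 0)" "reduced k q" "reduced (k - 1) r"
    using 7(5,6) by auto
  have p': "reduced (k - 1) p'" "p' \<noteq> Scalar 0"
    and drop_p': "\<And>N. evalh p' (drop 1 N) = evalh p (drop i N)"
    using 7(5) by (auto simp: p'_def)
  have prod: "POP i p \<otimes> POW j q r = POW j (POP i p \<otimes> q) (p' \<otimes> r)"
    by (simp add: p'_def)
  have xq: "reduced k (POP i p \<otimes> q)"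
    "\<And>N. length N = k \<Longrightarrow> evalh (POP i p \<otimes> q) N = evalh (POP i p) N * evalh q N"
    using 7(1,3)[of k] x y by (cases "i = 1"; blast)+
  have pr: "reduced (k - 1) (p' \<otimes> r)"
    "\<And>N. length N = k - 1 \<Longrightarrow> evalh (p' \<otimes> r) N = evalh p' N * evalh r N"
    using 7(2,4)[of "k - 1"] p' y by (cases "i = 1"; simp add: p'_def)+
  have "POP i p \<otimes> q \<noteq> Scalar 0"
    using evalh_product_nonzero[OF x(2) y(5) _ y(3) xq(2)] by simp
  moreover have "POP i p \<otimes> q \<noteq> POW m u (Scalar 0)" for m u
  proof
    assume eq: "POP i p \<otimes> q = POW m u (Scalar 0)"
    \<comment> \<open>Since the product is reduced, \<open>m > 0\<close>, so
      \<open>POW m u (Scalar 0)\<close> vanishes at \<open>0 # N\<close>. There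
      \<open>POP i p\<close> takes the value of \<open>p'\<close> at \<open>N\<close>.\<close>
    have "evalh p' N * evalh q (0 # N) = 0" if "length N = k - 1" for N
      using xq(1) xq(2)[of "0 # N"] drop_p'[of "0 # N"] that y(1) eq by (auto simp: power_0_left)
    then have "generic (k - 1) (\<lambda>N. False)"
      using generic_conj[OF generic_nonzero[OF p'] generic_nonzero_at_0[OF y(5,1,3,4)]]
      by (elim generic_mono) auto
    then show False by (simp add: not_generic_False)
  qed
  moreover have "evalh (p' \<otimes> r) (drop 1 N) = evalh p (drop i N) * evalh r (drop 1 N)"
    if "length N = k" for N
    using pr(2)[of "drop 1 N"] drop_p'[of N] that by simp
  ultimately show ?case
    unfolding prod using x y xq pr by (auto simp: algebra_simps)
next
  case (8 j q r i p)
  then show ?case by (metis shf_mult.simps(8) mult.commute)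
next
  case (9 i p q j r s)
  \<comment> \<open>These come from the four terms of
    \<open>(n ^ i * p + q) * (n ^ j * r + s)\<close>. \<open>shf_pop 1\<close> lifts
    \<open>s\<close> and \<open>q\<close> from the tail to all \<open>k\<close> variables.\<close>
  let ?pr = "p \<otimes> r" and ?qs = "q \<otimes> s"
    and ?ps = "p \<otimes> shf_pop 1 s" and ?rq = "r \<otimes> shf_pop 1 q"
  have k: "0 < k" "0 < i" "0 < j" "reduced k (shf_pop 1 s)" "reduced k (shf_pop 1 q)"
    using 9(5,6) by (auto intro: reduced_pop)
  have pr: "reduced k ?pr" "\<And>N. length N = k \<Longrightarrow> evalh ?pr N = evalh p N * evalh r N"
    using 9(1)[of k] 9(5,6) by auto
  have qs: "reduced (k - 1) ?qs"
    "\<And>N. length N = k \<Longrightarrow> evalh ?qs (drop 1 N) = evalh q (drop 1 N) * evalh s (drop 1 N)"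
    using 9(2)[of "k - 1"] 9(5,6) by auto
  have ps: "reduced k ?ps"
    "\<And>N. length N = k \<Longrightarrow> evalh ?ps N = evalh p N * evalh s (drop 1 N)"
    using 9(3)[of k] 9(5,6) k by auto
  have rq: "reduced k ?rq"
    "\<And>N. length N = k \<Longrightarrow> evalh ?rq N = evalh r N * evalh q (drop 1 N)"
    using 9(4)[of k] 9(5,6) k by auto
  have "reduced k (shf_pow (i + j) ?pr ?qs)" "reduced k (shf_pow i ?ps (Scalar 0))"
    "reduced k (shf_pow j ?rq (Scalar 0))"
    using k pr(1) qs(1) ps(1) rq(1) by (auto intro: reduced_pow)
  moreover from this have "evalh (POW i p q \<otimes> POW j r s) N =
      evalh (POW i p q) N * evalh (POW j r s) N" if "length N = k" for N
    using that k pr(2)[OF that] qs(2)[OF that] ps(2)[OF that] rq(2)[OF that]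
    by (cases N) (simp_all add: evalh_add[where k = k] reduced_add power_add algebra_simps)
  ultimately show ?case by (simp add: reduced_add)
qed simp_all

lemmas reduced_mult = shf_mult_correct[THEN conjunct1]
lemmas evalh_mult = shf_mult_correct[THEN conjunct2, rule_format]

section \<open>Negation, powers and normalization\<close>

text \<open>Negation rebuilds forms with bare constructors, so it must not turn an admissible
  leading coefficient into \<open>Scalar 0\<close> or \<open>POW j r (Scalar 0)\<close>.\<close>

lemma neg_eq_Scalar_0: "\<ominus> h = Scalar 0 \<longleftrightarrow> h = Scalar 0"
  by (cases h) auto

lemma reduced_neg: "reduced k h \<Longrightarrow> reduced k (\<ominus> h)"
proof (induction h arbitrary: k)
  case (POW i p q)
  then show ?case by (cases p) (auto simp: neg_eq_Scalar_0)
qed auto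

lemma evalh_neg: "evalh (\<ominus> h) N = - evalh h N"
  by (induction h arbitrary: N) auto

lemma shf_power_correct:
  "reduced k x \<Longrightarrow> reduced k (shf_power x n) \<and>
    (\<forall>N. length N = k \<longrightarrow> evalh (shf_power x n) N = evalh x N ^ n)"
  by (induction n) (auto simp: reduced_mult evalh_mult)

lemma position_nth: "distinct V \<Longrightarrow> i < length V \<Longrightarrow> position V (V ! i) = i"
  unfolding position_def by (rule the_equality) (auto simp: nth_eq_iff_index_eq)

text \<open>The number of variables is taken to be \<open>length N\<close>, possibly more than
  \<open>length V\<close>, so that the evaluation laws apply to \<open>N\<close> itself.\<close>

lemma shf_norm_correct:
  assumes "distinct V" and "length V \<le> length N"
    and assignment: "\<And>i. i < length V \<Longrightarrow> \<alpha> (V ! i) = N ! i"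
  shows "symbols f \<subseteq> set V \<Longrightarrow>
    reduced (length N) (shf_norm f V) \<and> evalh (shf_norm f V) N = evalp f \<alpha>"
proof (induction f)
  case (Var v)
  then obtain i where i: "i < length V" "v = V ! i" by (auto simp: in_set_conv_nth)
  \<comment> \<open>Nonemptiness makes \<open>POW 1 (Scalar 1) (Scalar 0)\<close> evaluate to the
    head of \<open>drop i N\<close> and not to the default 0.\<close>
  moreover from i have "drop i N \<noteq> []" "hd (drop i N) = N ! i"
    using assms(2) by (auto simp: hd_drop_conv_nth)
  ultimately show ?case
    using assms by (auto simp: position_nth intro!: reduced_pop)
next
  case (Expt f n)
  then show ?case by (auto simp: shf_power_correct)
qed (auto simp: reduced_add evalh_add reduced_mult evalh_mult reduced_neg evalh_neg)

theorem lemma4p3: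
  fixes V :: "'a list" and f :: "'a pterm" and N :: "int list" and \<alpha> :: "'a \<Rightarrow> int"
  assumes "distinct V"
    and "f \<in> poly_terms V"
    and "length N \<ge> length V"
    and "\<And>i. i < length V \<Longrightarrow> \<alpha> (V ! i) = N ! i"
  shows "shf_norm f V \<in> normal_forms \<and> evalh (shf_norm f V) N = evalp f \<alpha>"
  using shf_norm_correct[of V N \<alpha> f] assms
  by (auto simp: normal_forms_def poly_terms_def intro: reduced_imp_normal)

end
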